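(* Let $(X,d)$ be a metric space equipped with a closed partial order $\le$ satisfying the following property: given $x\le y$ in $X$ and $x_1\in X$, there exists $y_1\in X$ with $y_1\ge x_1$ and $d(y,y_1)\le d(x,x_1)$. Then for $\mu,\nu\in\mathcal{P}(X)$ the following are equivalent: (1) $\mu\le\nu$ in the stochastic order; (2) for every continuous monotone $f:X\to[0,\infty)$, $\int_X f\,d\mu\le\int_X f\,d\nu$; (2$'$) for every continuous bounded monotone $f:X\to[0,\infty)$, $\int_X f\,d\mu\le\int_X f\,d\nu$; (3) for every continuous antitone $f:X\to[0,\infty)$, $\int_X f\,d\nu\le\int_X f\,d\mu$; (3$'$) for every continuous bounded antitone $f:X\to[0,\infty)$, $\int_X f\,d\nu\le\int_X f\,d\mu$. (Integrals are allowed to be $+\infty$.)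
   Context: A partial order $\le$ on a metric space $X$ is closed if $\{(x,y):x\le y\}$ is closed in $X\times X$. A subset $A\subseteq X$ is an upper set if $x\in A$ and $x\le y$ imply $y\in A$. A real function $f$ on $X$ is monotone if $x\le y$ implies $f(x)\le f(y)$, and antitone if $x\le y$ implies $f(x)\ge f(y)$. $\mathcal{P}(X)$ denotes the set of Borel probability measures $\mu$ on $X$ satisfying all four of the following conditions: the support of $\mu$ has measure $1$; $\mu$ is $\tau$-additive, i.e. $\mu(U)=\sup_\alpha\mu(U_\alpha)$ for every directed union $U=\bigcup_\alpha U_\alpha$ of open sets; $\mu$ is the weak limit of a sequence of finitely supported measures; $\mu$ is inner regular, i.e. for every Borel set $A$ and $\varepsilon>0$ there is a compact $K\subseteq A$ with $\mu(A)-\varepsilon<\mu(K)$. (The first three are always equivalent, and all four are equivalent when $X$ is complete.) The stochastic order on $\mathcal{P}(X)$ is defined by: $\mu\le\nu$ if $\mu(U)\le\nu(U)$ for each open upper set $U\subseteq X$. *)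

theory Defs
  imports "HOL-Probability.Probability"
begin

definition upper_set :: "'a::order set \<Rightarrow> bool" where
  "upper_set A \<longleftrightarrow> (\<forall>x y. x \<in> A \<longrightarrow> x \<le> y \<longrightarrow> y \<in> A)"

definition borel_prob :: "'a::topological_space measure \<Rightarrow> bool" where
  "borel_prob M \<longleftrightarrow> prob_space M \<and> sets M = sets borel"

definition measure_support :: "'a::topological_space measure \<Rightarrow> 'a set" where
  "measure_support M = {x. \<forall>U. open U \<longrightarrow> x \<in> U \<longrightarrow> emeasure M U > 0}"

definition tau_additive :: "'a::topological_space measure \<Rightarrow> bool" where
  "tau_additive M \<longleftrightarrow>
    (\<forall>\<U>. \<U> \<noteq> {} \<longrightarrow> (\<forall>U\<in>\<U>. open U) \<longrightarrow>
         (\<forall>U\<in>\<U>. \<forall>V\<in>\<U>. \<exists>W\<in>\<U>. U \<union> V \<subseteq> W) \<longrightarrow>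
         emeasure M (\<Union>\<U>) = (SUP U\<in>\<U>. emeasure M U))"

text \<open>
  A finitely supported measure is one carried by a finite set, that is, a finite combination
  of point masses. Finiteness of \<^term>\<open>measure_support M\<close> alone would not say this on a
  nonseparable space, where the support of a probability measure may be null.
\<close>

definition finitely_supported :: "'a::t1_space measure \<Rightarrow> bool" where
  "finitely_supported M \<longleftrightarrow> (\<exists>F. finite F \<and> emeasure M (- F) = 0)"

definition weakly_converges ::
  "(nat \<Rightarrow> 'a::topological_space measure) \<Rightarrow> 'a measure \<Rightarrow> bool" where
  "weakly_converges S M \<longleftrightarrow>
    (\<forall>f :: 'a \<Rightarrow> real. continuous_on UNIV f \<longrightarrow> bounded (range f) \<longrightarrow>
       (\<lambda>n. \<integral>x. f x \<partial>S n) \<longlonglongrightarrow> (\<integral>x. f x \<partial>M))"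

definition compact_inner_regular :: "'a::topological_space measure \<Rightarrow> bool" where
  "compact_inner_regular M \<longleftrightarrow>
    (\<forall>A\<in>sets borel. \<forall>e>0. \<exists>K. compact K \<and> K \<subseteq> A \<and> measure M A - e < measure M K)"

definition regular_prob_measures :: "'a::metric_space measure set" where
  "regular_prob_measures =
    {M. borel_prob M
      \<and> emeasure M (measure_support M) = 1
      \<and> tau_additive M
      \<and> (\<exists>S. (\<forall>n. borel_prob (S n) \<and> finitely_supported (S n)) \<and> weakly_converges S M)
      \<and> compact_inner_regular M}"

definition stochastic_le ::
  "'a::{topological_space, order} measure \<Rightarrow> 'a measure \<Rightarrow> bool" where
  "stochastic_le M N \<longleftrightarrow> (\<forall>U. open U \<longrightarrow> upper_set U \<longrightarrow> emeasure M U \<le> emeasure N U)"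

end

(*
  Stochastic order gives the integral inequalities by the layer cake formula: superlevel sets
  of continuous monotone functions are open upper sets, and those of continuous antitone
  functions are complements of open upper sets.

  Conversely, the lifting property makes the distance to an upper set antitone, but says nothing
  about the distance to a lower set, so the complement of an open upper set U is of no use. Inner
  regularity repairs this: U is approximated by compact K, the up-closure of K is a closed upper
  set inside U, and the truncated multiples min 1 (n * infdist x (up-closure of K)) are bounded
  continuous antitone functions increasing to the indicator of its complement.
*)

theory Submission
  imports Defs
begin

section \<open>Layer cake formula\<close>

text \<open>Tonelli applied to the region under the graph of \<open>f\<close>. The parameter
  \<open>R\<close> covers strict and weak superlevel sets at once: the strict ones are open for
  continuous \<open>f\<close>, the weak ones have open complements, and each form is needed for one
  direction of monotonicity.\<close>

lemma nn_integral_layer_cake: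
  fixes f :: "'a \<Rightarrow> real" and R :: "real \<Rightarrow> real \<Rightarrow> bool"
  assumes M: "sigma_finite_measure M" and f [measurable]: "f \<in> borel_measurable M"
    and nonneg: "\<And>x. 0 \<le> f x" and R: "R = (<) \<or> R = (\<le>)"
  shows "(\<integral>\<^sup>+x. ennreal (f x) \<partial>M) =
    (\<integral>\<^sup>+t. indicator {0..} t * emeasure M {x \<in> space M. R t (f x)} \<partial>lborel)"
proof -
  interpret M: sigma_finite_measure M by (fact M)
  interpret pair_sigma_finite M lborel ..
  have R_meas: "Measurable.pred (M \<Otimes>\<^sub>M lborel) (\<lambda>(x, t). 0 \<le> t \<and> R t (f x))"
    using R by (elim disjE) (simp_all, measurable)
  have R_meas_section: "{x \<in> space M. R t (f x)} \<in> sets M" for t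
    using R by (elim disjE) simp_all
  \<comment> \<open>Indicator of the region under the graph: its integral over \<open>t\<close> is
    the length of \<open>{0..<f x}\<close> or \<open>{0..f x}\<close>, which is \<open>f x\<close>
    in both cases, and its integral over \<open>x\<close> is the measure of a superlevel
    set.\<close>
  define h :: "'a \<Rightarrow> real \<Rightarrow> ennreal" where "h = (\<lambda>x t. indicator {t. 0 \<le> t \<and> R t (f x)} t)"
  have h_meas: "(\<lambda>(x, t). h x t) \<in> borel_measurable (M \<Otimes>\<^sub>M lborel)"
  proof -
    have "(\<lambda>p. indicator {p. case p of (x, t) \<Rightarrow> 0 \<le> t \<and> R t (f x)} p :: ennreal)
      \<in> borel_measurable (M \<Otimes>\<^sub>M lborel)"
      using R_meas by measurable
    also have "(\<lambda>p. indicator {p. case p of (x, t) \<Rightarrow> 0 \<le> t \<and> R t (f x)} p :: ennreal) =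
      (\<lambda>(x, t). h x t)"
      by (auto simp: h_def indicator_def)
    finally show ?thesis .
  qed
  have "(\<integral>\<^sup>+t. h x t \<partial>lborel) = ennreal (f x)" for x
  proof -
    have "{t. 0 \<le> t \<and> R t (f x)} = {0..<f x} \<or> {t. 0 \<le> t \<and> R t (f x)} = {0..f x}"
      using R by auto
    then show ?thesis
      unfolding h_def using nonneg[of x] by (elim disjE) simp_all
  qed
  then have "(\<integral>\<^sup>+x. ennreal (f x) \<partial>M) = (\<integral>\<^sup>+x. \<integral>\<^sup>+t. h x t \<partial>lborel \<partial>M)"
    by simp
  also have "\<dots> = (\<integral>\<^sup>+t. \<integral>\<^sup>+x. h x t \<partial>M \<partial>lborel)"
    using Fubini'[OF h_meas] by simp
  also have "\<dots> = (\<integral>\<^sup>+t. indicator {0..} t * emeasure M {x \<in> space M. R t (f x)} \<partial>lborel)"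
  proof (rule nn_integral_cong)
    fix t :: real
    have "(\<integral>\<^sup>+x. h x t \<partial>M) =
      (\<integral>\<^sup>+x. indicator {0..} t * indicator {x \<in> space M. R t (f x)} x \<partial>M)"
      by (rule nn_integral_cong) (auto simp: h_def indicator_def)
    also have "\<dots> = indicator {0..} t * emeasure M {x \<in> space M. R t (f x)}"
      using R_meas_section by (simp add: nn_integral_cmult)
    finally show "(\<integral>\<^sup>+x. h x t \<partial>M) = indicator {0..} t * emeasure M {x \<in> space M. R t (f x)}" .
  qed
  finally show ?thesis .
qed

lemma nn_integral_le_if_superlevel_le:
  fixes f :: "'a \<Rightarrow> real"
  assumes "sigma_finite_measure M" "sigma_finite_measure N"
    and "f \<in> borel_measurable M" "f \<in> borel_measurable N"
    and "\<And>x. 0 \<le> f x" and "R = (<) \<or> R = (\<le>)"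
    and "\<And>t. emeasure M {x \<in> space M. R t (f x)} \<le> emeasure N {x \<in> space N. R t (f x)}"
  shows "(\<integral>\<^sup>+x. ennreal (f x) \<partial>M) \<le> (\<integral>\<^sup>+x. ennreal (f x) \<partial>N)"
  unfolding nn_integral_layer_cake[OF assms(1,3,5,6)] nn_integral_layer_cake[OF assms(2,4,5,6)]
  by (intro nn_integral_mono mult_left_mono assms(7)) simp

section \<open>Stochastic order implies the integral inequalities\<close>

lemma borel_probD:
  assumes "borel_prob M"
  shows "prob_space M" "sets M = sets borel" "space M = UNIV"
  using assms sets_eq_imp_space_eq[of M borel] by (auto simp: borel_prob_def)

lemma borel_prob_continuous_measurable:
  fixes f :: "'a::topological_space \<Rightarrow> real"
  assumes "borel_prob M" "continuous_on UNIV f"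
  shows "f \<in> borel_measurable M"
  using borel_measurable_continuous_onI[OF assms(2)] borel_probD(2)[OF assms(1)]
  by (simp cong: measurable_cong_sets)

text \<open>Both total masses are 1, so passing to complements reverses the comparison. This
  translates between upper sets and lower sets.\<close>

lemma emeasure_compl_le_iff:
  assumes "borel_prob M" "borel_prob N" "A \<in> sets borel"
  shows "emeasure M (- A) \<le> emeasure N (- A) \<longleftrightarrow> emeasure N A \<le> emeasure M A"
proof -
  interpret M: prob_space M by (rule borel_probD[OF assms(1)])
  interpret N: prob_space N by (rule borel_probD[OF assms(2)])
  have "measure M (- A) = 1 - measure M A" "measure N (- A) = 1 - measure N A"
    using M.prob_compl[of A] N.prob_compl[of A] assms
    by (simp_all add: Compl_eq_Diff_UNIV borel_probD(2,3)[OF assms(1)] borel_probD(2,3)[OF assms(2)])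
  then show ?thesis
    by (simp add: M.emeasure_eq_measure N.emeasure_eq_measure)
qed

lemma stochastic_le_nn_integral_mono:
  fixes f :: "'a::{topological_space, order} \<Rightarrow> real"
  assumes M: "borel_prob M" and N: "borel_prob N" and le: "stochastic_le M N"
    and f: "continuous_on UNIV f" "mono f" "\<And>x. 0 \<le> f x"
  shows "(\<integral>\<^sup>+x. ennreal (f x) \<partial>M) \<le> (\<integral>\<^sup>+x. ennreal (f x) \<partial>N)"
proof (rule nn_integral_le_if_superlevel_le[where R = "(<)"])
  fix t :: real
  have "open {x. t < f x}"
    using f(1) by (intro open_Collect_less continuous_on_const)
  moreover have "upper_set {x. t < f x}"
    using f(2) by (force simp: upper_set_def dest: monoD)
  ultimately show "emeasure M {x \<in> space M. t < f x} \<le> emeasure N {x \<in> space N. t < f x}"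
    using le by (simp add: borel_probD(3)[OF M] borel_probD(3)[OF N] stochastic_le_def)
qed (use M N f in \<open>simp_all add: borel_prob_continuous_measurable borel_probD(1)
    prob_space_imp_sigma_finite\<close>)

lemma stochastic_le_nn_integral_antimono:
  fixes f :: "'a::{topological_space, order} \<Rightarrow> real"
  assumes M: "borel_prob M" and N: "borel_prob N" and le: "stochastic_le M N"
    and f: "continuous_on UNIV f" "antimono f" "\<And>x. 0 \<le> f x"
  shows "(\<integral>\<^sup>+x. ennreal (f x) \<partial>N) \<le> (\<integral>\<^sup>+x. ennreal (f x) \<partial>M)"
\<comment> \<open>The weak relation is chosen because the complement of
  \<open>{x. t \<le> f x}\<close> is \<open>{x. f x < t}\<close>, an open upper set for continuous
  antitone \<open>f\<close>.\<close>
proof (rule nn_integral_le_if_superlevel_le[where R = "(\<le>)"])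
  fix t :: real
  have op: "open {x. f x < t}"
    using f(1) by (intro open_Collect_less continuous_on_const)
  moreover have "upper_set {x. f x < t}"
    using f(2) by (force simp: upper_set_def dest: antimonoD)
  ultimately have "emeasure M {x. f x < t} \<le> emeasure N {x. f x < t}"
    using le by (simp add: stochastic_le_def)
  moreover have "{x. t \<le> f x} = - {x. f x < t}"
    by auto
  ultimately show "emeasure N {x \<in> space N. t \<le> f x} \<le> emeasure M {x \<in> space M. t \<le> f x}"
    using op by (simp add: borel_probD(3)[OF M] borel_probD(3)[OF N] emeasure_compl_le_iff[OF N M])
qed (use M N f in \<open>simp_all add: borel_prob_continuous_measurable borel_probD(1)
    prob_space_imp_sigma_finite\<close>)

section \<open>From bounded monotone to bounded antitone functions\<close>

text \<open>If \<open>B\<close> bounds \<open>f\<close>, then \<open>B - f\<close> is an admissible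
  monotone test function. Its integral is \<open>B\<close> minus the integral of \<open>f\<close>,
  since the measures have mass 1 and all integrals are finite, so the inequality reverses.\<close>

lemma bounded_antimono_le_if_bounded_mono_le:
  fixes f :: "'a::{topological_space, order} \<Rightarrow> real"
  assumes M: "borel_prob M" and N: "borel_prob N"
    and le: "\<And>g :: 'a \<Rightarrow> real. continuous_on UNIV g \<Longrightarrow> bounded (range g) \<Longrightarrow> mono g \<Longrightarrow>
      (\<And>x. 0 \<le> g x) \<Longrightarrow> (\<integral>\<^sup>+x. ennreal (g x) \<partial>M) \<le> (\<integral>\<^sup>+x. ennreal (g x) \<partial>N)"
    and f: "continuous_on UNIV f" "bounded (range f)" "antimono f" "\<And>x. 0 \<le> f x"
  shows "(\<integral>\<^sup>+x. ennreal (f x) \<partial>N) \<le> (\<integral>\<^sup>+x. ennreal (f x) \<partial>M)"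
proof -
  obtain B where B: "\<And>x. \<bar>f x\<bar> \<le> B"
    using f(2) by (auto simp: bounded_iff)
  have fB: "f x \<le> B" for x
    using B[of x] by simp
  \<comment> \<open>The last of these facts makes \<open>B\<close> minus the integral nonnegative,
    so that the comparison in \<open>ennreal\<close> can be read off as one of real numbers.\<close>
  have int: "integrable P f" "(\<integral>\<^sup>+x. ennreal (f x) \<partial>P) = ennreal (\<integral>x. f x \<partial>P)"
      "(\<integral>\<^sup>+x. ennreal (B - f x) \<partial>P) = ennreal (B - (\<integral>x. f x \<partial>P))" "(\<integral>x. f x \<partial>P) \<le> B"
    if P: "borel_prob P" for P :: "'a measure"
  proof -
    interpret P: prob_space P by (rule borel_probD[OF P])
    show i: "integrable P f"
      using B borel_prob_continuous_measurable[OF P f(1)] by (intro P.integrable_const_bound) auto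
    show "(\<integral>\<^sup>+x. ennreal (f x) \<partial>P) = ennreal (\<integral>x. f x \<partial>P)"
      using i f(4) by (intro nn_integral_eq_integral) auto
    show "(\<integral>\<^sup>+x. ennreal (B - f x) \<partial>P) = ennreal (B - (\<integral>x. f x \<partial>P))"
      using i fB by (subst nn_integral_eq_integral) (auto simp: P.prob_space)
    show "(\<integral>x. f x \<partial>P) \<le> B"
      using i fB by (intro P.integral_le_const) auto
  qed
  have "(\<integral>\<^sup>+x. ennreal (B - f x) \<partial>M) \<le> (\<integral>\<^sup>+x. ennreal (B - f x) \<partial>N)"
  proof (rule le)
    show "continuous_on UNIV (\<lambda>x. B - f x)"
      using f(1) by (intro continuous_intros)
    show "bounded (range (\<lambda>x. B - f x))"
      using fB f(4) by (intro boundedI[of _ B]) auto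
    show "mono (\<lambda>x. B - f x)"
      using f(3) by (auto intro!: monoI dest: antimonoD)
  qed (use fB in auto)
  then show ?thesis
    using int[OF M] int[OF N] by (simp add: ennreal_leI)
qed

section \<open>Up-closures and the distance to an upper set\<close>

definition up_closure :: "'a::order set \<Rightarrow> 'a set" where
  "up_closure A = {y. \<exists>x\<in>A. x \<le> y}"

lemma upper_set_up_closure: "upper_set (up_closure A)"
  by (auto simp: upper_set_def up_closure_def intro: order_trans)

lemma subset_up_closure: "A \<subseteq> up_closure A"
  by (auto simp: up_closure_def)

lemma up_closure_subset: "upper_set U \<Longrightarrow> A \<subseteq> U \<Longrightarrow> up_closure A \<subseteq> U"
  by (auto simp: upper_set_def up_closure_def)

text \<open>Choose points of \<open>K\<close> below the members of a convergent sequence.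
  Compactness lets a subsequence of them converge in \<open>K\<close>, and the closed order passes
  to the limit. For a merely closed set the points below could escape to infinity.\<close>

lemma closed_up_closure_compact:
  fixes K :: "'a::{metric_space, order} set"
  assumes closed_order: "closed {(x, y). (x::'a) \<le> y}" and K: "compact K"
  shows "closed (up_closure K)"
  unfolding closed_sequential_limits
proof (intro allI impI, elim conjE)
  fix y l
  assume "\<forall>n. y n \<in> up_closure K" and lim: "y \<longlonglongrightarrow> l"
  then obtain k where k: "\<And>n. k n \<in> K" "\<And>n. k n \<le> y n"
    unfolding up_closure_def by simp metis
  obtain k' r where k': "k' \<in> K" "strict_mono (r :: nat \<Rightarrow> nat)" "(k \<circ> r) \<longlonglongrightarrow> k'"
    using K k(1) by (metis compact_def)
  have "(\<lambda>n. ((k \<circ> r) n, (y \<circ> r) n)) \<longlonglongrightarrow> (k', l)"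
    using k'(3) LIMSEQ_subseq_LIMSEQ[OF lim k'(2)] by (rule tendsto_Pair)
  moreover have "((k \<circ> r) n, (y \<circ> r) n) \<in> {(x, y). x \<le> y}" for n
    by (simp add: k(2))
  ultimately have "(k', l) \<in> {(x, y). x \<le> y}"
    by (rule closed_sequentially[OF closed_order, rotated])
  with k'(1) show "l \<in> up_closure K"
    by (auto simp: up_closure_def)
qed

text \<open>For \<open>x \<le> y\<close> and \<open>a \<in> A\<close>, lifting gives some
  \<open>b\<close> above \<open>a\<close> that is at most as far from \<open>y\<close> as
  \<open>a\<close> is from \<open>x\<close>; as \<open>A\<close> is an upper set, \<open>b\<close>
  lies in it. Hence every distance from \<open>x\<close> to a point of \<open>A\<close> bounds
  \<open>infdist y A\<close>.\<close>

lemma antimono_infdist_upper_set: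
  fixes A :: "'a::{metric_space, order} set"
  assumes lifting: "\<And>x y x1 :: 'a. x \<le> y \<Longrightarrow> \<exists>y1. x1 \<le> y1 \<and> dist y y1 \<le> dist x x1"
    and A: "upper_set A"
  shows "antimono (\<lambda>x. infdist x A)"
proof (rule antimonoI)
  fix x y :: 'a
  assume "x \<le> y"
  show "infdist y A \<le> infdist x A"
  \<comment> \<open>By convention \<open>infdist\<close> to the empty set is 0, which makes the
    function constant in that case.\<close>
  proof (cases "A = {}")
    case False
    have "infdist y A \<le> dist x a" if "a \<in> A" for a
    proof -
      obtain b where "a \<le> b" "dist y b \<le> dist x a"
        using lifting[OF \<open>x \<le> y\<close>] by blast
      with A that show ?thesis
        by (meson infdist_le2 upper_set_def)
    qed
    with False show ?thesis
      by (simp add: infdist_notempty[of A x] cINF_greatest)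
  qed (simp add: infdist_def)
qed

section \<open>Bounded antitone functions determine the stochastic order\<close>

text \<open>Monotone convergence: the truncated multiples vanish on \<open>C\<close>, and off
  \<open>C\<close> the distance is positive because \<open>C\<close> is closed, so they eventually
  equal 1. For empty \<open>C\<close> the default value 0 of \<open>infdist\<close> would make the
  right-hand side 0.\<close>

lemma emeasure_compl_closed_eq_SUP:
  fixes C :: "'a::metric_space set"
  assumes P: "borel_prob P" and C: "closed C" "C \<noteq> {}"
  shows "emeasure P (- C) = (SUP n. \<integral>\<^sup>+x. ennreal (min 1 (real n * infdist x C)) \<partial>P)"
proof -
  define g where "g = (\<lambda>n x. ennreal (min 1 (real n * infdist x C)))"
  have meas: "g n \<in> borel_measurable P" for n
    unfolding g_def
    by (intro measurable_compose[OF borel_prob_continuous_measurable[OF P] measurable_ennreal]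
        continuous_intros)
  have inc: "incseq g"
    unfolding g_def
    by (intro incseq_SucI le_funI ennreal_leI min.mono mult_right_mono order.refl)
      (auto simp: infdist_nonneg)
  have "(SUP n. g n x) = indicator (- C) x" for x
  proof (cases "x \<in> C")
    case True
    then show ?thesis by (simp add: g_def)
  next
    case False
    then have "infdist x C > 0"
      using C by (metis infdist_nonneg in_closed_iff_infdist_zero order_less_le)
    then obtain n where "1 \<le> real n * infdist x C"
      using reals_Archimedean3 less_imp_le by metis
    then have "g n x = 1"
      by (simp add: g_def)
    moreover have "g m x \<le> 1" for m
      unfolding g_def using ennreal_leI[of _ 1] by simp
    ultimately have "(SUP n. g n x) = 1"
      by (intro antisym SUP_least) (auto intro: SUP_upper2[of n])
    with False show ?thesis by simp
  qed
  then have "(SUP n. \<integral>\<^sup>+x. g n x \<partial>P) = (\<integral>\<^sup>+x. indicator (- C) x \<partial>P)"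
    using nn_integral_monotone_convergence_SUP[OF inc meas] by simp
  also have "\<dots> = emeasure P (- C)"
    using C borel_probD(2)[OF P] by (intro nn_integral_indicator) auto
  finally show ?thesis
    by (simp add: g_def)
qed

lemma stochastic_le_if_bounded_antimono_le:
  fixes M N :: "'a::{metric_space, order} measure"
  assumes closed_order: "closed {(x, y). (x::'a) \<le> y}"
    and lifting: "\<And>x y x1 :: 'a. x \<le> y \<Longrightarrow> \<exists>y1. x1 \<le> y1 \<and> dist y y1 \<le> dist x x1"
    and M: "borel_prob M" "compact_inner_regular M" and N: "borel_prob N"
    and le: "\<And>f :: 'a \<Rightarrow> real. continuous_on UNIV f \<Longrightarrow> bounded (range f) \<Longrightarrow> antimono f \<Longrightarrow>
      (\<And>x. 0 \<le> f x) \<Longrightarrow> (\<integral>\<^sup>+x. ennreal (f x) \<partial>N) \<le> (\<integral>\<^sup>+x. ennreal (f x) \<partial>M)"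
  shows "stochastic_le M N"
  unfolding stochastic_le_def
proof (intro allI impI)
  fix U :: "'a set"
  assume U: "open U" "upper_set U"
  interpret M: prob_space M by (rule borel_probD[OF M(1)])
  interpret N: prob_space N by (rule borel_probD[OF N])
  \<comment> \<open>With \<open>C\<close> the up-closure of \<open>K\<close>, the chain is M(K)
    \<le> M(C) \<le> N(C) \<le> N(U). The outer inequalities are inclusions; the middle one comes
    from the complements of \<open>C\<close>. Nonempty \<open>K\<close> ensures nonempty
    \<open>C\<close>.\<close>
  have K_le: "measure M K \<le> measure N U" if K: "compact K" "K \<subseteq> U" for K
  proof (cases "K = {}")
    case False
    let ?C = "up_closure K"
    have C: "closed ?C" "?C \<noteq> {}"
      using closed_up_closure_compact[OF closed_order K(1)] subset_up_closure[of K] False by auto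
    \<comment> \<open>Both sides are suprema over \<open>n\<close> of integrals of the same bounded
      continuous antitone functions, so \<open>le\<close> compares them term by term.\<close>
    have "emeasure N (- ?C) \<le> emeasure M (- ?C)"
      unfolding emeasure_compl_closed_eq_SUP[OF N C] emeasure_compl_closed_eq_SUP[OF M(1) C]
    proof (intro SUP_mono' le)
      fix n
      show "continuous_on UNIV (\<lambda>x. min 1 (real n * infdist x ?C))"
        by (intro continuous_intros)
      show "bounded (range (\<lambda>x. min 1 (real n * infdist x ?C)))"
        by (intro boundedI[of _ 1]) (auto simp: infdist_nonneg)
      have "antimono (\<lambda>x. infdist x ?C)"
        by (rule antimono_infdist_upper_set[OF lifting upper_set_up_closure])
      then show "antimono (\<lambda>x. min 1 (real n * infdist x ?C))"
        by (intro antimonoI min.mono mult_left_mono) (auto dest: antimonoD)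
    qed (simp add: infdist_nonneg)
    then have "emeasure M ?C \<le> emeasure N ?C"
      using C by (simp add: emeasure_compl_le_iff[OF N M(1)])
    then have "measure M ?C \<le> measure N ?C"
      by (simp add: M.emeasure_eq_measure N.emeasure_eq_measure)
    moreover have "measure M K \<le> measure M ?C"
      using C borel_probD(2)[OF M(1)] by (intro M.finite_measure_mono subset_up_closure) auto
    moreover have "measure N ?C \<le> measure N U"
      using U K borel_probD(2)[OF N] by (intro N.finite_measure_mono up_closure_subset) auto
    ultimately show ?thesis by simp
  qed simp
  have "measure M U \<le> measure N U"
  proof (rule field_le_epsilon)
    fix e :: real
    assume "e > 0"
    then obtain K where "compact K" "K \<subseteq> U" "measure M U - e < measure M K"
      using M(2) borel_open[OF U(1)] unfolding compact_inner_regular_def by meson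
    with K_le[of K] show "measure M U \<le> measure N U + e"
      by linarith
  qed
  then show "emeasure M U \<le> emeasure N U"
    by (simp add: M.emeasure_eq_measure N.emeasure_eq_measure)
qed

section \<open>Equivalence of the five conditions\<close>

theorem proposition3p8:
  fixes \<mu> \<nu> :: "'a::{metric_space, order} measure"
  assumes closed_order: "closed {(x, y). (x::'a) \<le> y}"
    and lifting: "\<And>x y x1 :: 'a. x \<le> y \<Longrightarrow> \<exists>y1. x1 \<le> y1 \<and> dist y y1 \<le> dist x x1"
    and mu: "\<mu> \<in> regular_prob_measures"
    and nu: "\<nu> \<in> regular_prob_measures"
  shows
    "(stochastic_le \<mu> \<nu> \<longleftrightarrow>
       (\<forall>f :: 'a \<Rightarrow> real. continuous_on UNIV f \<longrightarrow> mono f \<longrightarrow> (\<forall>x. 0 \<le> f x) \<longrightarrow>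
          (\<integral>\<^sup>+x. ennreal (f x) \<partial>\<mu>) \<le> (\<integral>\<^sup>+x. ennreal (f x) \<partial>\<nu>)))
   \<and> (stochastic_le \<mu> \<nu> \<longleftrightarrow>
       (\<forall>f :: 'a \<Rightarrow> real. continuous_on UNIV f \<longrightarrow> bounded (range f) \<longrightarrow> mono f \<longrightarrow> (\<forall>x. 0 \<le> f x) \<longrightarrow>
          (\<integral>\<^sup>+x. ennreal (f x) \<partial>\<mu>) \<le> (\<integral>\<^sup>+x. ennreal (f x) \<partial>\<nu>)))
   \<and> (stochastic_le \<mu> \<nu> \<longleftrightarrow>
       (\<forall>f :: 'a \<Rightarrow> real. continuous_on UNIV f \<longrightarrow> antimono f \<longrightarrow> (\<forall>x. 0 \<le> f x) \<longrightarrow>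
          (\<integral>\<^sup>+x. ennreal (f x) \<partial>\<nu>) \<le> (\<integral>\<^sup>+x. ennreal (f x) \<partial>\<mu>)))
   \<and> (stochastic_le \<mu> \<nu> \<longleftrightarrow>
       (\<forall>f :: 'a \<Rightarrow> real. continuous_on UNIV f \<longrightarrow> bounded (range f) \<longrightarrow> antimono f \<longrightarrow> (\<forall>x. 0 \<le> f x) \<longrightarrow>
          (\<integral>\<^sup>+x. ennreal (f x) \<partial>\<nu>) \<le> (\<integral>\<^sup>+x. ennreal (f x) \<partial>\<mu>)))"
proof -
  have M: "borel_prob \<mu>" "compact_inner_regular \<mu>" and N: "borel_prob \<nu>"
    using mu nu by (simp_all add: regular_prob_measures_def)
  note mono_le = stochastic_le_nn_integral_mono[OF M(1) N]
    and antimono_le = stochastic_le_nn_integral_antimono[OF M(1) N]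
    and bounded_antimono_le = bounded_antimono_le_if_bounded_mono_le[OF M(1) N]
  have stochastic_leI: "stochastic_le \<mu> \<nu>"
    if "\<And>f :: 'a \<Rightarrow> real. continuous_on UNIV f \<Longrightarrow> bounded (range f) \<Longrightarrow> antimono f \<Longrightarrow>
      (\<And>x. 0 \<le> f x) \<Longrightarrow> (\<integral>\<^sup>+x. ennreal (f x) \<partial>\<nu>) \<le> (\<integral>\<^sup>+x. ennreal (f x) \<partial>\<mu>)"
    by (rule stochastic_le_if_bounded_antimono_le) (fact closed_order lifting M N that)+
  \<comment> \<open>Monotone test functions reach the stochastic order only through antitone ones,
    by the reflection \<open>B - f\<close>.\<close>
  have stochastic_leI': "stochastic_le \<mu> \<nu>"
    if "\<And>f :: 'a \<Rightarrow> real. continuous_on UNIV f \<Longrightarrow> bounded (range f) \<Longrightarrow> mono f \<Longrightarrow>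
      (\<And>x. 0 \<le> f x) \<Longrightarrow> (\<integral>\<^sup>+x. ennreal (f x) \<partial>\<mu>) \<le> (\<integral>\<^sup>+x. ennreal (f x) \<partial>\<nu>)"
    by (intro stochastic_leI bounded_antimono_le that) auto
  show ?thesis
    \<comment> \<open>In the converse directions, a condition on all continuous functions is used
      only for the bounded ones.\<close>
    apply (intro conjI iffI)
    subgoal using mono_le by blast
    subgoal by (rule stochastic_leI') blast
    subgoal using mono_le by blast
    subgoal by (rule stochastic_leI') blast
    subgoal using antimono_le by blast
    subgoal by (rule stochastic_leI) blast
    subgoal using antimono_le by blast
    subgoal by (rule stochastic_leI) blast
    done
qed

end
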